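(* Let $n>1$, let $X_1<X_2<\dots<X_n$ be the ordered observations with empirical distribution function $\mathbb{F}_n$, let $\hat\varphi_n$ be the log-concave maximum likelihood estimator of the log-density and $\hat F_n(x)=\int_{-\infty}^x\exp\hat\varphi_n(r)\,dr$. Let $\widetilde\varphi:\mathbb{R}\to[-\infty,\infty)$ be a concave function which is (real-valued and) linear on all intervals $[X_j,X_{j+1}]$, $1\le j<n$, while $\widetilde\varphi=-\infty$ on $\mathbb{R}\setminus[X_1,X_n]$. Define $\widetilde F(x):=\int_{-\infty}^x\exp\widetilde\varphi(r)\,dr$ and assume further that $\widetilde F(X_n)=1$. Then $\widetilde\varphi=\hat\varphi_n$ and $\widetilde F=\hat F_n$ if, and only if, for arbitrary $t\in[X_1,X_n]$, $$\int_{X_1}^t\widetilde F(r)\,dr\le\int_{X_1}^t\mathbb{F}_n(r)\,dr,$$ with equality in the case of $t\in\mathcal{S}_n(\widetilde\varphi)$.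
   Context: $\mathbb{F}_n$ is the distribution function of the uniform distribution on $\{X_1,\dots,X_n\}$. For concave $\varphi:\mathbb{R}\to[-\infty,\infty)$ put $\Psi_n(\varphi):=\int\varphi\,d\mathbb{F}_n-\int_{\mathbb{R}}\exp\varphi(x)\,dx$, with $\exp(-\infty)=0$. The estimator $\hat\varphi_n$ is the maximizer of $\Psi_n$ over all concave functions $\mathbb{R}\to[-\infty,\infty)$. It is known that it exists, is unique, is linear on each $[X_j,X_{j+1}]$, $1\le j<n$, and equals $-\infty$ on $\mathbb{R}\setminus[X_1,X_n]$. For a continuous, piecewise linear function $h:[X_1,X_n]\to\mathbb{R}$, its set of knots is $\mathcal{S}_n(h):=\{t\in(X_1,X_n):h'(t-)\ne h'(t+)\}\cup\{X_1,X_n\}$; $\mathcal{S}_n(\widetilde\varphi)$ refers to the restriction of $\widetilde\varphi$ to $[X_1,X_n]$. *)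

theory Defs
  imports "HOL-Probability.Probability"
begin

text \<open>Functions \<open>\<real> \<rightarrow> [-\<infinity>, \<infinity>)\<close> are rendered as functions into \<^typ>\<open>ereal\<close> that avoid \<open>\<infinity>\<close>.
  Since \<open>\<infinity>\<close> is excluded and the weights are strictly positive, the convex combination below
  never has the form \<open>\<infinity> - \<infinity>\<close> or \<open>0 * (-\<infinity>)\<close>.\<close>

definition ext_concave :: "(real \<Rightarrow> ereal) \<Rightarrow> bool" where
  "ext_concave \<phi> \<longleftrightarrow> (\<forall>x. \<phi> x \<noteq> \<infinity>) \<and>
     (\<forall>x y t. 0 < t \<and> t < 1 \<longrightarrow>
        ereal (1 - t) * \<phi> x + ereal t * \<phi> y \<le> \<phi> ((1 - t) * x + t * y))"

text \<open>The value at \<open>\<infinity>\<close> is irrelevant: it is never attained by an \<^const>\<open>ext_concave\<close> function.\<close>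

definition exp_ext :: "ereal \<Rightarrow> real" where
  "exp_ext a = (if \<bar>a\<bar> = \<infinity> then 0 else exp (real_of_ereal a))"

text \<open>The extended-real Lebesgue integral, i.e. the integral of the positive part minus that of the
  negative part; \<^const>\<open>e2ennreal\<close> maps negative numbers to \<open>0\<close>.\<close>

definition ext_integral :: "'a measure \<Rightarrow> ('a \<Rightarrow> ereal) \<Rightarrow> ereal" where
  "ext_integral M f =
     enn2ereal (\<integral>\<^sup>+ x. e2ennreal (f x) \<partial>M) - enn2ereal (\<integral>\<^sup>+ x. e2ennreal (- f x) \<partial>M)"

definition empirical_measure :: "nat \<Rightarrow> (nat \<Rightarrow> real) \<Rightarrow> real measure" where
  "empirical_measure n X = measure_pmf (pmf_of_set (X ` {1..n}))"

definition empirical_cdf :: "nat \<Rightarrow> (nat \<Rightarrow> real) \<Rightarrow> real \<Rightarrow> real" where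
  "empirical_cdf n X = cdf (empirical_measure n X)"

text \<open>The second integral is \<open>\<infinity>\<close> if \<open>exp \<phi>\<close> is not integrable, in which case the
  functional is \<open>-\<infinity>\<close>.\<close>

definition Psi :: "nat \<Rightarrow> (nat \<Rightarrow> real) \<Rightarrow> (real \<Rightarrow> ereal) \<Rightarrow> ereal" where
  "Psi n X \<phi> = ext_integral (empirical_measure n X) \<phi>
     - enn2ereal (\<integral>\<^sup>+ x. ennreal (exp_ext (\<phi> x)) \<partial>lborel)"

definition log_concave_mle :: "nat \<Rightarrow> (nat \<Rightarrow> real) \<Rightarrow> (real \<Rightarrow> ereal) \<Rightarrow> bool" where
  "log_concave_mle n X \<phi> \<longleftrightarrow>
     ext_concave \<phi> \<and> (\<forall>\<psi>. ext_concave \<psi> \<longrightarrow> Psi n X \<psi> \<le> Psi n X \<phi>)"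

definition cdf_of_log_density :: "(real \<Rightarrow> ereal) \<Rightarrow> real \<Rightarrow> real" where
  "cdf_of_log_density \<phi> x = (LINT r:{..x}|lborel. exp_ext (\<phi> r))"

definition linear_on_interval :: "(real \<Rightarrow> ereal) \<Rightarrow> real \<Rightarrow> real \<Rightarrow> bool" where
  "linear_on_interval \<phi> a b \<longleftrightarrow> (\<exists>c d. \<forall>x\<in>{a..b}. \<phi> x = ereal (c * x + d))"

text \<open>Knots of a continuous, piecewise linear function on \<open>[a, b]\<close>; for such functions both
  one-sided derivatives exist at every interior point.\<close>

definition knots :: "real \<Rightarrow> real \<Rightarrow> (real \<Rightarrow> real) \<Rightarrow> real set" where
  "knots a b h =
     {t \<in> {a<..<b}. \<exists>l r. (h has_real_derivative l) (at_left t) \<and>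
        (h has_real_derivative r) (at_right t) \<and> l \<noteq> r} \<union> {a, b}"

end

theory Submission
  imports Defs
begin

text \<open>By partial integration, \<open>\<Delta> t\<close>, the integral of \<open>F_n - F\<close> over \<open>[X 1, t]\<close>, equals the integral of
  the hinge \<open>max 0 (t - x)\<close> against \<open>d(F_n - F)(x)\<close>. A continuous function that is linear between
  the observations is a constant plus a combination of the hinges at \<open>X j\<close>, \<open>2 \<le> j \<le> n\<close>, whose
  coefficient for \<open>j < n\<close> is its change of slope at \<open>X j\<close>. Hence its integral against \<open>d(F_n - F)\<close>
  is \<open>\<Sum>j=2..n. kink j * \<Delta> (X j)\<close>. If \<open>\<Delta>\<close> satisfies the stated conditions, this is nonpositive for
  concave functions and vanishes for the candidate; with the tangent inequality for \<open>exp\<close>, every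
  maximizer must then coincide with the candidate. Conversely, a maximizer may be perturbed by
  \<open>- \<epsilon> * max 0 (t - x)\<close>, and by \<open>\<epsilon> * max 0 (t - x)\<close> for small \<open>\<epsilon>\<close> if \<open>t\<close> is a knot, which yields
  \<open>\<Delta> t \<ge> 0\<close>, and \<open>\<Delta> t = 0\<close> at the knots.\<close>

section \<open>Elementary facts on exp and on null sets\<close>

text \<open>Controls the second-order error when a maximizer is perturbed. For
  \<open>u = - a < 0\<close> the claim reads \<open>1 \<le> (1 - a + a\<^sup>2) * exp a\<close>;
  there \<open>exp a\<close> is replaced by its quadratic Taylor polynomial, and the resulting
  product has no negative coefficients.\<close>

lemma exp_le_quadratic:
  fixes u :: real
  assumes "\<bar>u\<bar> \<le> 1"
  shows "exp u \<le> 1 + u + u\<^sup>2"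
proof (cases "u \<ge> 0")
  case True
  then show ?thesis using exp_bound assms by auto
next
  case False
  define a where "a = - u"
  have a: "a \<ge> 0" using False by (simp add: a_def)
  have pos: "1 - a + a\<^sup>2 > 0"
    using zero_le_power2[of "a - 1/2"] by (simp add: power2_eq_square algebra_simps)
  have "1 \<le> 1 + a\<^sup>2 / 2 + a ^ 3 / 2 + a ^ 4 / 2"
    using a by simp
  also have "\<dots> = (1 - a + a\<^sup>2) * (1 + a + a\<^sup>2 / 2)"
    by (simp add: field_simps power2_eq_square power3_eq_cube power4_eq_xxxx)
  also have "\<dots> \<le> (1 - a + a\<^sup>2) * exp a"
    using pos exp_lower_Taylor_quadratic[OF a] by (intro mult_left_mono) auto
  finally show ?thesis
    by (simp add: a_def exp_minus field_simps)
qed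

text \<open>A nonempty open interval has positive measure and so does not fit into a null set. This
  turns almost-everywhere equalities into equalities at points in prescribed places.\<close>

lemma AE_lborel_point_in_interval:
  fixes a b :: real
  assumes "AE x in lborel. P x" "a < b"
  obtains x where "a < x" "x < b" "P x"
proof -
  have "\<exists>x. a < x \<and> x < b \<and> P x"
  proof (rule ccontr)
    assume "\<not> ?thesis"
    then have sub: "{a<..<b} \<subseteq> {x. \<not> P x}"
      by auto
    obtain N where N: "{x \<in> space lborel. \<not> P x} \<subseteq> N" "N \<in> null_sets lborel"
      using assms(1) by (auto elim!: AE_E3 simp: eventually_ae_filter)
    have "emeasure lborel {a<..<b} \<le> emeasure lborel N"
      using N sub by (intro emeasure_mono) auto
    then show False
      using N assms(2) by auto
  qed
  then show ?thesis
    using that by blast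
qed

section \<open>Concave functions with values in \<open>[-\<infinity>, \<infinity>)\<close>\<close>

lemma ext_concaveD:
  assumes "ext_concave \<psi>" "0 < t" "t < 1"
  shows "ereal (1 - t) * \<psi> x + ereal t * \<psi> y \<le> \<psi> ((1 - t) * x + t * y)"
  using assms by (auto simp: ext_concave_def)

lemma ext_concave_not_PInf: "ext_concave \<psi> \<Longrightarrow> \<psi> x \<noteq> \<infinity>"
  by (auto simp: ext_concave_def)

text \<open>Lower bounds at \<open>x\<close> and \<open>y\<close> suffice because a convex
  combination is monotone in both values. \<open>ext_concave_min_le\<close> uses this freedom with
  the constant \<open>min a b\<close> at both ends.\<close>

lemma ext_concave_chord:
  assumes "ext_concave \<psi>" "x < z" "z < y" "\<psi> x \<ge> ereal a" "\<psi> y \<ge> ereal b"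
  shows "\<psi> z \<ge> ereal (a + (b - a) / (y - x) * (z - x))"
proof -
  define t where "t = (z - x) / (y - x)"
  have t: "0 < t" "t < 1"
    using assms by (auto simp: t_def)
  have "t * (y - x) = z - x"
    using assms by (simp add: t_def)
  then have z: "(1 - t) * x + t * y = z"
    by (simp add: algebra_simps)
  have "ereal (a + (b - a) / (y - x) * (z - x)) = ereal ((1 - t) * a + t * b)"
    by (simp add: t_def algebra_simps diff_divide_distrib)
  also have "\<dots> = ereal (1 - t) * ereal a + ereal t * ereal b"
    by simp
  also have "\<dots> \<le> ereal (1 - t) * \<psi> x + ereal t * \<psi> y"
    using t assms by (intro add_mono ereal_mult_left_mono) auto
  also have "\<dots> \<le> \<psi> z"
    using ext_concaveD[OF assms(1) t, of x y] z by simp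
  finally show ?thesis .
qed

lemma ext_concave_finite_between:
  assumes "ext_concave \<psi>" "x < z" "z < y" "\<psi> x \<noteq> -\<infinity>" "\<psi> y \<noteq> -\<infinity>"
  shows "\<psi> z \<noteq> -\<infinity>"
proof -
  have "\<psi> x \<noteq> \<infinity>" "\<psi> y \<noteq> \<infinity>"
    using ext_concave_not_PInf[OF assms(1)] by auto
  then obtain a b where "\<psi> x = ereal a" "\<psi> y = ereal b"
    using assms(4,5) by (metis ereal_cases)
  then show ?thesis
    using ext_concave_chord[OF assms(1-3), of a b] by auto
qed

lemma exp_ext_ereal [simp]: "exp_ext (ereal r) = exp r"
  by (simp add: exp_ext_def)

lemma exp_ext_MInf [simp]: "exp_ext (-\<infinity>) = 0"
  by (simp add: exp_ext_def)

lemma exp_ext_nonneg [simp]: "exp_ext a \<ge> 0"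
  by (simp add: exp_ext_def)

lemma exp_ext_eq_0_iff: "exp_ext a = 0 \<longleftrightarrow> \<bar>a\<bar> = \<infinity>"
  by (simp add: exp_ext_def)

lemma exp_ext_mono: "a \<le> b \<Longrightarrow> b \<noteq> \<infinity> \<Longrightarrow> exp_ext a \<le> exp_ext b"
  by (cases a; cases b) (auto simp: exp_ext_def)

lemma ext_concave_min_le:
  assumes "ext_concave \<psi>" "x < z" "z < y"
  shows "min (\<psi> x) (\<psi> y) \<le> \<psi> z"
proof (cases "\<psi> x = -\<infinity> \<or> \<psi> y = -\<infinity>")
  case False
  then obtain a b where ab: "\<psi> x = ereal a" "\<psi> y = ereal b"
    using ext_concave_not_PInf[OF assms(1)] by (metis ereal_cases)
  show ?thesis
    using ext_concave_chord[OF assms, of "min a b" "min a b"] ab by (auto simp: min_def)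
qed (auto simp: min_def)

text \<open>A concave function is quasiconcave, so the superlevel sets are intervals and hence
  Borel.\<close>

lemma borel_measurable_exp_ext_concave [measurable]:
  assumes "ext_concave \<psi>"
  shows "(\<lambda>x. exp_ext (\<psi> x)) \<in> borel_measurable borel"
proof (subst borel_measurable_iff_greater, intro allI)
  fix a
  have "is_interval {w. a < exp_ext (\<psi> w)}"
    unfolding is_interval_1
  proof safe
    fix x y z
    assume *: "a < exp_ext (\<psi> x)" "a < exp_ext (\<psi> y)" "x \<le> z" "z \<le> y"
    show "a < exp_ext (\<psi> z)"
    proof (cases "x = z \<or> y = z")
      case False
      then have "min (\<psi> x) (\<psi> y) \<le> \<psi> z"
        using * by (intro ext_concave_min_le[OF assms]) auto
      then have "exp_ext (min (\<psi> x) (\<psi> y)) \<le> exp_ext (\<psi> z)"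
        using ext_concave_not_PInf[OF assms] by (intro exp_ext_mono) auto
      then show ?thesis
        using * by (auto simp: min_def split: if_splits)
    qed (use * in auto)
  qed
  then show "{w \<in> space borel. a < exp_ext (\<psi> w)} \<in> sets borel"
    by (simp add: real_interval_borel_measurable)
qed

lemma ext_concave_extend:
  assumes "concave_on {a..b} u"
  shows "ext_concave (\<lambda>x. if x \<in> {a..b} then ereal (u x) else -\<infinity>)"
  unfolding ext_concave_def
proof (intro conjI allI impI)
  fix x y t :: real
  assume t: "0 < t \<and> t < 1"
  show "ereal (1 - t) * (if x \<in> {a..b} then ereal (u x) else - \<infinity>) +
       ereal t * (if y \<in> {a..b} then ereal (u y) else - \<infinity>)
       \<le> (if (1 - t) * x + t * y \<in> {a..b} then ereal (u ((1 - t) * x + t * y)) else - \<infinity>)"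
  proof (cases "x \<in> {a..b} \<and> y \<in> {a..b}")
    case True
    then have "(1 - t) * x + t * y \<in> {a..b}"
      using convexD_alt[OF concave_on_imp_convex[OF assms], of x y t] t by auto
    moreover have "(1 - t) * u x + t * u y \<le> u ((1 - t) * x + t * y)"
      using concave_onD[OF assms, of t x y] t True by simp
    ultimately show ?thesis
      using True by simp
  next
    case False
    then show ?thesis
      using t by auto
  qed
qed auto

lemma concave_on_hinge:
  fixes c t :: real
  assumes S: "convex S" and c: "c \<le> 0"
  shows "concave_on S (\<lambda>x. c * max 0 (t - x))"
proof -
  have "c * max 0 (t - ((1 - s) *\<^sub>R x + s *\<^sub>R y))
      \<ge> (1 - s) * (c * max 0 (t - x)) + s * (c * max 0 (t - y))" if "0 < s" "s < 1" for s x y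
  proof -
    have "(1 - s) * (t - x) \<le> (1 - s) * max 0 (t - x)" "s * (t - y) \<le> s * max 0 (t - y)"
      using that by (auto intro!: mult_left_mono)
    moreover have "0 \<le> (1 - s) * max 0 (t - x)" "0 \<le> s * max 0 (t - y)"
      using that by auto
    moreover have "t - ((1 - s) * x + s * y) = (1 - s) * (t - x) + s * (t - y)"
      by (simp add: algebra_simps)
    ultimately have "max 0 (t - ((1 - s) * x + s * y)) \<le> (1 - s) * max 0 (t - x) + s * max 0 (t - y)"
      by linarith
    from mult_left_mono_neg[OF this c] show ?thesis
      by (simp add: algebra_simps)
  qed
  then show ?thesis
    using S by (intro concave_on_linorderI) auto
qed

section \<open>The ordered sample, its empirical measure and \<open>Psi\<close>\<close>

locale ordered_sample =
  fixes n :: nat and X :: "nat \<Rightarrow> real"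
  assumes n: "n > 1" and X: "strict_mono_on {1..n} X"
begin

text \<open>Keeps simp from turning \<open>X 1\<close> into \<open>X (Suc 0)\<close>.\<close>

declare One_nat_def [simp del]

abbreviation supp :: "real set" where "supp \<equiv> {X 1..X n}"

definition sample_mean :: "(real \<Rightarrow> real) \<Rightarrow> real" where
  "sample_mean h = (\<Sum>j=1..n. h (X j)) / n"

definition extend :: "(real \<Rightarrow> real) \<Rightarrow> real \<Rightarrow> ereal" where
  "extend u x = (if x \<in> supp then ereal (u x) else -\<infinity>)"

lemma X_less: "1 \<le> i \<Longrightarrow> i < j \<Longrightarrow> j \<le> n \<Longrightarrow> X i < X j"
  using X by (auto simp: strict_mono_on_def)

lemma X_le: "1 \<le> i \<Longrightarrow> i \<le> j \<Longrightarrow> j \<le> n \<Longrightarrow> X i \<le> X j"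
  using X_less[of i j] by (cases "i = j") auto

lemma X_in_supp: "1 \<le> j \<Longrightarrow> j \<le> n \<Longrightarrow> X j \<in> supp"
  using X_le[of 1 j] X_le[of j n] by auto

lemma X_1_less_n: "X 1 < X n"
  using X_less[of 1 n] n by auto

lemma inj_X: "inj_on X {1..n}"
  using X by (rule strict_mono_on_imp_inj_on)

lemma segment_of:
  assumes "x \<in> supp"
  obtains k where "k \<in> {1..<n}" "X k \<le> x" "x \<le> X (k + 1)"
proof -
  have "\<exists>k\<in>{1..<n}. X k \<le> x \<and> x \<le> X (k + 1)" if "X 1 \<le> x" "x \<le> X m" "2 \<le> m" "m \<le> n" for m
    using that(3,2,4)
  proof (induction m rule: dec_induct)
    case base
    then show ?case
      using that by (intro bexI[of _ 1]) (auto simp: numeral_2_eq_2)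
  next
    case (step m)
    then show ?case
      by (cases "x \<le> X m") (auto intro!: bexI[of _ m] simp flip: Suc_eq_plus1)
  qed
  from this[of n] assms n that show ?thesis
    by auto
qed

lemma sample_mean_add: "sample_mean (\<lambda>x. f x + g x) = sample_mean f + sample_mean g"
  by (simp add: sample_mean_def sum.distrib add_divide_distrib)

lemma sample_mean_diff: "sample_mean (\<lambda>x. f x - g x) = sample_mean f - sample_mean g"
  by (simp add: sample_mean_def sum_subtractf diff_divide_distrib)

lemma sample_mean_cmult: "sample_mean (\<lambda>x. c * f x) = c * sample_mean f"
  by (simp add: sample_mean_def sum_distrib_left)

lemma sample_mean_const: "sample_mean (\<lambda>x. c) = c"
  using n by (simp add: sample_mean_def)

text \<open>The observations are distinct, so each of them carries the weight
  \<open>1 / n\<close>.\<close>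

lemma nn_integral_empirical:
  "(\<integral>\<^sup>+ x. f x \<partial>empirical_measure n X) = (\<Sum>j=1..n. f (X j)) / n"
  unfolding empirical_measure_def using n inj_X
  by (subst nn_integral_pmf_of_set) (auto simp: sum.reindex card_image)

lemma empirical_cdf_eq:
  "empirical_cdf n X r = (\<Sum>j=1..n. indicator {X j..} r) / n"
proof -
  have "empirical_cdf n X r = real (card (X ` {1..n} \<inter> {..r})) / n"
    unfolding empirical_cdf_def cdf_def empirical_measure_def using n inj_X
    by (subst measure_pmf_of_set) (auto simp: card_image)
  also have "X ` {1..n} \<inter> {..r} = X ` {j\<in>{1..n}. X j \<le> r}"
    by auto
  also have "real (card \<dots>) = real (card {j\<in>{1..n}. X j \<le> r})"
    by (subst card_image) (auto intro: inj_on_subset[OF inj_X])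
  also have "\<dots> = (\<Sum>j=1..n. indicator {X j..} r)"
    by (simp add: indicator_def sum.If_cases Int_def)
  finally show ?thesis .
qed

lemma ext_integral_empirical:
  assumes "\<And>j. j \<in> {1..n} \<Longrightarrow> \<psi> (X j) = ereal (u (X j))"
  shows "ext_integral (empirical_measure n X) \<psi> = ereal (sample_mean u)"
proof -
  have e: "enn2ereal ((\<Sum>j=1..n. e2ennreal (ereal (h j))) / n) = ereal ((\<Sum>j=1..n. max 0 (h j)) / n)"
    for h :: "nat \<Rightarrow> real"
  proof -
    have "(\<Sum>j=1..n. e2ennreal (ereal (h j))) = (\<Sum>j=1..n. ennreal (max 0 (h j)))"
      by (intro sum.cong) (auto simp: max_def ennreal_neg)
    also have "\<dots> / n = ennreal ((\<Sum>j=1..n. max 0 (h j)) / n)"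
      using n by (subst sum_ennreal)
        (auto simp: ennreal_of_nat_eq_real_of_nat divide_ennreal sum_nonneg simp del: ennreal_max_0')
    finally show ?thesis
      by (simp add: sum_nonneg)
  qed
  have "ext_integral (empirical_measure n X) \<psi> =
      ereal ((\<Sum>j=1..n. max 0 (u (X j))) / n) - ereal ((\<Sum>j=1..n. max 0 (- u (X j))) / n)"
    unfolding ext_integral_def nn_integral_empirical e[symmetric] using assms
    by (auto intro!: arg_cong2[where f = "(-)"] arg_cong[where f = enn2ereal]
        arg_cong2[where f = "(/)"] sum.cong)
  also have "\<dots> = ereal (sample_mean u)"
    by (auto simp: sample_mean_def diff_divide_distrib[symmetric] sum_subtractf[symmetric]
        intro!: arg_cong2[where f = "(/)"] sum.cong)
  finally show ?thesis .
qed

text \<open>One infinite summand makes the negative part infinite, while the positive part stays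
  finite because \<open>\<psi>\<close> avoids \<open>\<infinity>\<close>; so no
  \<open>\<infinity> - \<infinity>\<close> arises.\<close>

lemma ext_integral_empirical_MInf:
  assumes "j \<in> {1..n}" "\<psi> (X j) = -\<infinity>" "\<And>x. \<psi> x \<noteq> \<infinity>"
  shows "ext_integral (empirical_measure n X) \<psi> = -\<infinity>"
proof -
  have "e2ennreal (- \<psi> (X j)) \<le> (\<Sum>i=1..n. e2ennreal (- \<psi> (X i)))"
    using assms(1) by (intro member_le_sum) auto
  then have sum_top: "(\<Sum>i=1..n. e2ennreal (- \<psi> (X i))) = top"
    using assms(2) by (simp add: top_unique)
  have neg: "(\<integral>\<^sup>+ x. e2ennreal (- \<psi> x) \<partial>empirical_measure n X) = top"
    unfolding nn_integral_empirical sum_top by (simp add: ennreal_top_divide)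
  have pos: "e2ennreal (\<psi> x) = ennreal (max 0 (real_of_ereal (\<psi> x)))" for x
    using assms(3)[of x] by (cases "\<psi> x") (auto simp: e2ennreal_neg max_def ennreal_neg)
  have "(\<Sum>i=1..n. e2ennreal (\<psi> (X i))) = ennreal (\<Sum>i=1..n. max 0 (real_of_ereal (\<psi> (X i))))"
    unfolding pos by (rule sum_ennreal) simp
  then have "(\<Sum>i=1..n. e2ennreal (\<psi> (X i))) / n \<noteq> top"
    using n by (auto simp: ennreal_divide_eq_top_iff)
  then have fin: "enn2ereal ((\<Sum>i=1..n. e2ennreal (\<psi> (X i))) / n) \<noteq> \<infinity>"
    by (metis enn2ereal_eq_top_iff infinity_ennreal_def top_ereal_def)
  have "a - \<infinity> = -\<infinity>" if "a \<noteq> \<infinity>" for a :: ereal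
    using that by (cases a) auto
  from this[OF fin] show ?thesis
    unfolding ext_integral_def neg nn_integral_empirical by simp
qed

lemma Psi_eq:
  assumes "\<And>j. j \<in> {1..n} \<Longrightarrow> \<psi> (X j) = ereal (u (X j))"
    and "integrable lborel (\<lambda>x. exp_ext (\<psi> x))"
  shows "Psi n X \<psi> = ereal (sample_mean u - (LINT x|lborel. exp_ext (\<psi> x)))"
  using assms(2) unfolding Psi_def
  by (subst ext_integral_empirical[of \<psi> u]) (auto simp: assms(1) nn_integral_eq_integral)

text \<open>Applied to competitors at least as good as the candidate. The value
  \<open>-\<infinity>\<close> at an observation or a divergent integral of
  \<open>exp_ext (\<psi> x)\<close> would force \<open>Psi\<close> down to
  \<open>-\<infinity>\<close>.\<close>

lemma Psi_not_MInfD: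
  assumes "ext_concave \<psi>" "Psi n X \<psi> \<noteq> -\<infinity>"
  shows "j \<in> {1..n} \<Longrightarrow> \<psi> (X j) = ereal (real_of_ereal (\<psi> (X j)))"
    and "integrable lborel (\<lambda>x. exp_ext (\<psi> x))"
proof -
  have fin: "\<psi> (X j) = ereal (real_of_ereal (\<psi> (X j)))" if "j \<in> {1..n}" for j
  proof -
    have "-\<infinity> - enn2ereal z = -\<infinity>" for z
      using enn2ereal_nonneg[of z] by (cases "enn2ereal z") auto
    then have "\<psi> (X j) \<noteq> -\<infinity>"
      using assms(2) ext_integral_empirical_MInf[of j \<psi>] that ext_concave_not_PInf[OF assms(1)]
      by (auto simp: Psi_def)
    then show ?thesis
      using ext_concave_not_PInf[OF assms(1), of "X j"] by (cases "\<psi> (X j)") auto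
  qed
  then show "j \<in> {1..n} \<Longrightarrow> \<psi> (X j) = ereal (real_of_ereal (\<psi> (X j)))" .
  have "(\<integral>\<^sup>+ x. ennreal (exp_ext (\<psi> x)) \<partial>lborel) \<noteq> top"
    using assms(2) ext_integral_empirical[of \<psi> "\<lambda>x. real_of_ereal (\<psi> x)"] fin
    by (auto simp: Psi_def)
  then show "integrable lborel (\<lambda>x. exp_ext (\<psi> x))"
    using assms(1) by (intro integrableI_nonneg) (auto simp: less_top)
qed

lemma exp_ext_extend: "exp_ext (extend u x) = indicator supp x * exp (u x)"
  by (simp add: extend_def)

lemma integrable_supp:
  fixes h :: "real \<Rightarrow> real"
  assumes "continuous_on supp h"
  shows "integrable lborel (\<lambda>x. indicator supp x * h x)"
  using borel_integrable_atLeastAtMost'[OF assms] by (simp add: set_integrable_def)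

lemma Psi_extend:
  assumes "continuous_on supp u"
  shows "Psi n X (extend u) = ereal (sample_mean u - (LINT x|lborel. indicator supp x * exp (u x)))"
  using X_in_supp integrable_supp[of "\<lambda>x. exp (u x)"] assms
  by (subst Psi_eq[of _ u]) (auto simp: exp_ext_extend continuous_on_exp, auto simp: extend_def)

section \<open>Integrated distribution functions as means of hinges\<close>

text \<open>After exchanging sum and integral, the jump at \<open>X j\<close> contributes the length
  of \<open>{X j..t}\<close> divided by \<open>n\<close>, and this length is the hinge
  \<open>max 0 (t - X j)\<close>.\<close>

lemma integral_empirical_cdf:
  assumes "t \<in> supp"
  shows "(LINT r:{X 1..t}|lborel. empirical_cdf n X r) = sample_mean (\<lambda>x. max 0 (t - x))"
proof -
  have "(LINT r:{X 1..t}|lborel. empirical_cdf n X r) =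
      (LINT r|lborel. (\<Sum>j=1..n. indicator {X j..t} r) / n)"
    unfolding set_lebesgue_integral_def empirical_cdf_eq
  proof (intro Bochner_Integration.integral_cong refl)
    fix r
    have "indicator {X 1..t} r * indicator {X j..} r = (indicator {X j..t} r :: real)" if "j \<in> {1..n}" for j
      using that X_le[of 1 j] by (auto simp: indicator_def)
    then show "indicator {X 1..t} r *\<^sub>R ((\<Sum>j=1..n. indicator {X j..} r) / real n) = (\<Sum>j=1..n. indicator {X j..t} r) / real n"
      by (simp add: sum_distrib_left)
  qed
  also have "\<dots> = (\<Sum>j=1..n. (LINT r|lborel. indicator {X j..t} r)) / n"
    by (subst integral_divide_zero, subst Bochner_Integration.integral_sum)
       (auto intro!: integrable_real_indicator simp: emeasure_lborel_Icc_eq)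
  also have "\<dots> = sample_mean (\<lambda>x. max 0 (t - x))"
    unfolding sample_mean_def
    by (intro arg_cong2[where f = "(/)"] sum.cong) (auto simp: max_def)
  finally show ?thesis .
qed

lemma cdf_of_log_density_extend:
  assumes "continuous_on supp g" "x \<in> supp"
  shows "cdf_of_log_density (extend g) x = integral {X 1..x} (\<lambda>r. exp (g r))"
proof -
  have c: "continuous_on {X 1..x} (\<lambda>r. exp (g r))"
    using assms by (intro continuous_on_exp continuous_on_subset[OF assms(1)]) auto
  have "cdf_of_log_density (extend g) x = (LINT r:{X 1..x}|lborel. exp (g r))"
    unfolding cdf_of_log_density_def set_lebesgue_integral_def exp_ext_extend
    by (rule Bochner_Integration.integral_cong) (use assms in \<open>auto simp: indicator_def\<close>)
  also have "\<dots> = integral {X 1..x} (\<lambda>r. exp (g r))"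
    by (intro set_borel_integral_eq_integral borel_integrable_atLeastAtMost' c)
  finally show ?thesis .
qed

text \<open>Partial integration: the derivative of \<open>(t - x) * F x\<close> is
  \<open>(t - x) * exp (g x) - F x\<close>, and the product vanishes at \<open>t\<close> by its
  first factor and at \<open>X 1\<close> by \<open>F (X 1) = 0\<close>.\<close>

lemma integral_cdf_of_log_density:
  assumes "continuous_on supp g" "t \<in> supp"
  shows "(LINT r:{X 1..t}|lborel. cdf_of_log_density (extend g) r) =
    (LINT x|lborel. indicator supp x * (max 0 (t - x) * exp (g x)))"
proof -
  define F where "F = (\<lambda>x. integral {X 1..x} (\<lambda>r. exp (g r)))"
  have cont: "continuous_on {X 1..t} g"
    using assms by (auto intro: continuous_on_subset)
  have F: "(F has_real_derivative exp (g x)) (at x within {X 1..t})" if "x \<in> {X 1..t}" for x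
    unfolding F_def using that cont by (intro integral_has_real_derivative continuous_on_exp)
  have contF: "continuous_on {X 1..t} F"
    using F by (intro DERIV_continuous_on) auto
  have "(LINT x|lborel. indicator {X 1..t} x *\<^sub>R ((t - x) * exp (g x) - F x)) = (t - t) * F t - (t - X 1) * F (X 1)"
  proof (rule integral_FTC_atLeastAtMost)
    fix x assume "X 1 \<le> x" "x \<le> t"
    then show "((\<lambda>x. (t - x) * F x) has_vector_derivative (t - x) * exp (g x) - F x) (at x within {X 1..t})"
      unfolding has_real_derivative_iff_has_vector_derivative[symmetric]
      by (auto intro!: derivative_eq_intros F simp: algebra_simps)
  qed (use assms in \<open>auto intro!: continuous_intros cont contF\<close>)
  also have "\<dots> = 0"
    by (simp add: F_def)
  finally have "0 = (LINT x|lborel. indicator {X 1..t} x *\<^sub>R ((t - x) * exp (g x)) - indicator {X 1..t} x *\<^sub>R F x)"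
    by (simp add: algebra_simps)
  also have "\<dots> = (LINT x|lborel. indicator {X 1..t} x *\<^sub>R ((t - x) * exp (g x))) - (LINT x:{X 1..t}|lborel. F x)"
    unfolding set_lebesgue_integral_def
    by (intro Bochner_Integration.integral_diff borel_integrable_compact)
       (auto intro!: continuous_intros cont contF)
  also have "(LINT x:{X 1..t}|lborel. F x) = (LINT r:{X 1..t}|lborel. cdf_of_log_density (extend g) r)"
    using assms by (intro set_lebesgue_integral_cong)
      (auto simp: F_def cdf_of_log_density_extend[OF assms(1)])
  also have "(LINT x|lborel. indicator {X 1..t} x *\<^sub>R ((t - x) * exp (g x))) =
      (LINT x|lborel. indicator supp x * (max 0 (t - x) * exp (g x)))"
    by (rule Bochner_Integration.integral_cong) (use assms in \<open>auto simp: indicator_def max_def\<close>)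
  finally show ?thesis
    by simp
qed

section \<open>Piecewise linear interpolation in terms of hinges\<close>

text \<open>\<open>slope y n = 0\<close> by convention, so that \<open>kink y n\<close> is minus the last slope.\<close>

definition slope :: "(nat \<Rightarrow> real) \<Rightarrow> nat \<Rightarrow> real" where
  "slope y j = (if j < n then (y (j + 1) - y j) / (X (j + 1) - X j) else 0)"

definition kink :: "(nat \<Rightarrow> real) \<Rightarrow> nat \<Rightarrow> real" where
  "kink y j = slope y j - slope y (j - 1)"

text \<open>The piecewise linear interpolant of the values \<open>y j\<close> at the observations
  \<open>X j\<close>. Its hinges vanish to the right of their nodes, so the expansion starts from
  the value \<open>y n\<close> at the right end.\<close>

definition interp :: "(nat \<Rightarrow> real) \<Rightarrow> real \<Rightarrow> real" where
  "interp y x = y n + (\<Sum>j=2..n. kink y j * max 0 (X j - x))"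

text \<open>Descending induction from \<open>n\<close>, where the conventional slope
  \<open>0\<close> fits the empty sum. The hinge at \<open>X (k+1)\<close> preserves the value at
  that node and changes the slope to its left from \<open>slope y (k+1)\<close> to
  \<open>slope y k\<close>.\<close>

lemma sum_kink_hinges:
  assumes "1 \<le> k" "k \<le> n"
  shows "y n + (\<Sum>j=k+1..n. kink y j * (X j - x)) = y k + slope y k * (x - X k)"
  using assms(2,1)
proof (induction k rule: inc_induct)
  case base
  then show ?case by (simp add: slope_def)
next
  case (step k)
  have split: "(\<Sum>j=k+1..n. kink y j * (X j - x)) =
      kink y (k+1) * (X (k+1) - x) + (\<Sum>j=k+1+1..n. kink y j * (X j - x))"
    using step by (subst sum.atLeast_Suc_atMost) (auto simp flip: Suc_eq_plus1)
  have "slope y k * (X (k+1) - X k) = y (k+1) - y k"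
    using step X_less[of k "k+1"] by (simp add: slope_def)
  then have y: "y (k+1) = y k + slope y k * (X (k+1) - X k)"
    by simp
  have IH: "y n + (\<Sum>j=k+1+1..n. kink y j * (X j - x)) = y (k+1) + slope y (k+1) * (x - X (k+1))"
    using step.IH by (simp only: Suc_eq_plus1 le_add2 simp_thms)
  have "y n + (\<Sum>j=k+1..n. kink y j * (X j - x)) =
      kink y (k+1) * (X (k+1) - x) + (y (k+1) + slope y (k+1) * (x - X (k+1)))"
    unfolding split IH[symmetric] by simp
  also have "\<dots> = y (k+1) + slope y k * (x - X (k+1))"
    by (simp add: kink_def algebra_simps)
  also have "\<dots> = y k + slope y k * (x - X k)"
    by (subst y) (simp add: algebra_simps)
  finally show ?case .
qed

lemma interp_segment:
  assumes "k \<in> {1..<n}" "X k \<le> x" "x \<le> X (k + 1)"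
  shows "interp y x = y k + slope y k * (x - X k)"
proof -
  \<comment> \<open>On this segment the hinges at nodes up to \<open>X k\<close> vanish and the
    remaining ones are affine.\<close>
  have "(\<Sum>j=2..n. kink y j * max 0 (X j - x)) = (\<Sum>j=k+1..n. kink y j * (X j - x))"
  proof (rule sum.mono_neutral_cong_right)
    show "\<forall>i\<in>{2..n} - {k + 1..n}. kink y i * max 0 (X i - x) = 0"
    proof
      fix i assume "i \<in> {2..n} - {k + 1..n}"
      then show "kink y i * max 0 (X i - x) = 0"
        using assms X_le[of i k] by auto
    qed
    show "kink y j * max 0 (X j - x) = kink y j * (X j - x)" if "j \<in> {k + 1..n}" for j
      using assms that X_le[of "k+1" j] by auto
  qed (use assms in auto)
  then show ?thesis
    unfolding interp_def using sum_kink_hinges[of k y x] assms by simp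
qed

lemma slope_times: "k \<in> {1..<n} \<Longrightarrow> slope y k * (X (k + 1) - X k) = y (k + 1) - y k"
  using X_less[of k "k+1"] by (simp add: slope_def)

lemma interp_X: "j \<in> {1..n} \<Longrightarrow> interp y (X j) = y j"
proof (cases "j < n")
  case True
  moreover assume "j \<in> {1..n}"
  ultimately show ?thesis
    using X_le[of j "j+1"] by (subst interp_segment[of j]) auto
next
  case False
  moreover assume "j \<in> {1..n}"
  ultimately have "j = n" by simp
  moreover have "(\<Sum>i=2..n. kink y i * max 0 (X i - X n)) = 0"
    using X_le[of _ n] by (intro sum.neutral) auto
  ultimately show ?thesis
    by (simp add: interp_def)
qed

lemma continuous_on_interp [continuous_intros]: "continuous_on A (interp y)"
  unfolding interp_def by (intro continuous_intros)

lemma linear_on_segments_eq_interp: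
  assumes "\<forall>j\<in>{1..<n}. linear_on_interval \<phi> (X j) (X (j + 1))" "x \<in> supp"
  shows "\<phi> x = ereal (interp (\<lambda>j. real_of_ereal (\<phi> (X j))) x)"
proof -
  obtain k where k: "k \<in> {1..<n}" "X k \<le> x" "x \<le> X (k + 1)"
    using segment_of[OF assms(2)] .
  obtain c d where cd: "\<And>z. z \<in> {X k..X (k + 1)} \<Longrightarrow> \<phi> z = ereal (c * z + d)"
    using bspec[OF assms(1) k(1)] unfolding linear_on_interval_def by blast
  have X: "X k < X (k + 1)"
    using k X_less[of k "k+1"] by auto
  define y where "y = (\<lambda>j. real_of_ereal (\<phi> (X j)))"
  have "y k = c * X k + d" "y (k + 1) = c * X (k + 1) + d"
    using cd X by (auto simp: y_def)
  moreover from this have "slope y k = c"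
    using k X by (simp add: slope_def flip: right_diff_distrib)
  ultimately have "interp y x = c * x + d"
    using interp_segment[OF k, of y] by (simp add: algebra_simps)
  then show ?thesis
    using cd k by (simp add: y_def)
qed

lemma ext_concave_ge_interp:
  assumes "ext_concave \<psi>" "\<And>j. j \<in> {1..n} \<Longrightarrow> \<psi> (X j) = ereal (y j)" "x \<in> supp"
  shows "\<psi> x \<ge> ereal (interp y x)"
proof -
  obtain k where k: "k \<in> {1..<n}" "X k \<le> x" "x \<le> X (k + 1)"
    using segment_of[OF assms(3)] .
  consider "x = X k" | "x = X (k + 1)" | "X k < x" "x < X (k + 1)"
    using k by linarith
  then show ?thesis
  proof cases
    case 3
    then show ?thesis
      using ext_concave_chord[OF assms(1) 3, of "y k" "y (k+1)"] assms(2) k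
      by (simp add: interp_segment[OF k] slope_def)
  qed (use k assms(2) interp_X in auto)
qed

lemma kink_nonpos:
  assumes "ext_concave \<psi>" "\<And>j. j \<in> {1..n} \<Longrightarrow> \<psi> (X j) = ereal (y j)" "j \<in> {2..<n}"
  shows "kink y j \<le> 0"
proof -
  define k where "k = j - 1"
  have k: "k \<in> {1..<n}" "j \<in> {1..<n}" "j = k + 1"
    using assms(3) by (auto simp: k_def)
  have X: "X k < X j" "X j < X (j + 1)"
    using k X_less[of k j] X_less[of j "j+1"] by auto
  have "ereal (y j) \<ge> ereal (y k + (y (j + 1) - y k) / (X (j + 1) - X k) * (X j - X k))"
    using ext_concave_chord[OF assms(1) X, of "y k" "y (j+1)"] assms(2) k by auto
  then have *: "(y (j + 1) - y k) / (X (j + 1) - X k) * (X j - X k) \<le> y j - y k"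
    by simp
  define a b where "a = X j - X k" and "b = X (j + 1) - X j"
  have ab: "a > 0" "b > 0" "X (j + 1) - X k = a + b"
    using X by (auto simp: a_def b_def)
  have y: "y j - y k = slope y k * a" "y (j + 1) - y j = slope y j * b"
    using slope_times[of k y] slope_times[of j y] k by (auto simp: a_def b_def)
  \<comment> \<open>The chord slope over both segments is the average of their slopes with weights
    proportional to \<open>a\<close> and \<open>b\<close>; if it is at most the left slope, so is
    the right slope.\<close>
  then have "y (j + 1) - y k = slope y k * a + slope y j * b"
    by simp
  with * ab have "(slope y k * a + slope y j * b) / (a + b) * a \<le> slope y k * a"
    by (simp add: y(1) flip: a_def)
  then have "slope y j \<le> slope y k"
    using ab by (simp add: field_simps)
  then show ?thesis
    by (simp add: kink_def k_def)
qed

text \<open>The sign condition stops before \<open>n\<close> because on \<open>supp\<close> the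
  hinge at \<open>X n\<close> is affine, hence concave with a coefficient of either sign.\<close>

lemma concave_on_hinges:
  assumes "\<And>j. j \<in> {2..<n} \<Longrightarrow> c j \<le> 0"
  shows "concave_on supp (\<lambda>x. a + (\<Sum>j=2..n. c j * max 0 (X j - x)))"
proof -
  have sum: "finite A \<Longrightarrow> A \<subseteq> {2..<n} \<Longrightarrow> concave_on supp (\<lambda>x. \<Sum>j\<in>A. c j * max 0 (X j - x))" for A
  proof (induction A rule: finite_induct)
    case empty
    then show ?case by (simp add: concave_on_const)
  next
    case (insert j A)
    then show ?case
      using assms by (simp add: concave_on_add concave_on_hinge)
  qed
  have "{2..n} = insert n {2..<n}"
    using n by auto
  then have eq: "(\<Sum>j=2..n. c j * max 0 (X j - x)) = c n * max 0 (X n - x) + (\<Sum>j=2..<n. c j * max 0 (X j - x))" for x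
    by simp
  have last: "concave_on supp (\<lambda>x. c n * max 0 (X n - x))"
  proof (rule concave_on_linorderI)
    fix s x y :: real assume s: "0 < s" "s < 1" "x \<in> supp" "y \<in> supp"
    then have "(1 - s) *\<^sub>R x + s *\<^sub>R y \<in> supp"
      by (intro convexD_alt) auto
    with s show "(1 - s) * (c n * max 0 (X n - x)) + s * (c n * max 0 (X n - y))
      \<le> c n * max 0 (X n - ((1 - s) *\<^sub>R x + s *\<^sub>R y))"
      by (simp add: algebra_simps)
  qed auto
  show ?thesis
    unfolding eq using sum[of "{2..<n}"] last
    by (intro concave_on_add) (auto simp: concave_on_const)
qed

section \<open>Knots and changes of slope\<close>

text \<open>Hinges at nodes other than \<open>t\<close> are affine near \<open>t\<close>. If no node
  at \<open>t\<close> had a nonzero kink, the interpolant would be differentiable there and its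
  one-sided derivatives would agree.\<close>

lemma knotsE:
  assumes "t \<in> knots (X 1) (X n) h" "\<And>x. x \<in> supp \<Longrightarrow> h x = interp y x" "t \<noteq> X 1" "t \<noteq> X n"
  obtains j where "j \<in> {2..<n}" "t = X j" "kink y j \<noteq> 0"
proof (rule ccontr)
  note knot = that
  assume neg: "\<not> thesis"
  from assms obtain l r where lr: "(h has_real_derivative l) (at_left t)"
      "(h has_real_derivative r) (at_right t)" "l \<noteq> r" and t: "X 1 < t" "t < X n"
    by (auto simp: knots_def)
  \<comment> \<open>The index \<open>n\<close> is included although \<open>kink y n\<close> may be
    nonzero: \<open>t < X n\<close> excludes \<open>X n = t\<close>.\<close>
  have kink0: "kink y j = 0" if "j \<in> {2..n}" "X j = t" for j
    using that neg t knot[of j] by (cases "j = n") auto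
  have "\<exists>D. ((\<lambda>x. kink y j * max 0 (X j - x)) has_real_derivative D) (at t)" if "j \<in> {2..n}" for j
  proof (cases "X j = t")
    case True
    then show ?thesis
      using kink0[OF that] by (auto intro!: exI[of _ 0])
  next
    case False
    have "((\<lambda>x. kink y j * max 0 (X j - x)) has_real_derivative (if X j < t then 0 else - kink y j)) (at t)"
    proof (cases "X j < t")
      case True
      show ?thesis
        by (rule has_field_derivative_transform_within_open[where S = "{X j<..}" and f = "\<lambda>_. 0"])
           (use True in auto)
    next
      case F: False
      show ?thesis
        by (rule has_field_derivative_transform_within_open[where S = "{..<X j}" and f = "\<lambda>x. kink y j * (X j - x)"])
           (use F False in \<open>auto intro!: derivative_eq_intros\<close>)
    qed
    then show ?thesis by blast
  qed
  then obtain D where D: "\<And>j. j \<in> {2..n} \<Longrightarrow> ((\<lambda>x. kink y j * max 0 (X j - x)) has_real_derivative D j) (at t)"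
    by metis
  have "((\<lambda>x. \<Sum>j=2..n. kink y j * max 0 (X j - x)) has_real_derivative (\<Sum>j=2..n. D j)) (at t)"
    by (rule DERIV_sum) (rule D)
  from DERIV_add[OF DERIV_const[of "y n"] this]
  have "(interp y has_real_derivative (\<Sum>j=2..n. D j)) (at t)"
    by (simp add: interp_def[abs_def])
  then have "(h has_real_derivative (\<Sum>j=2..n. D j)) (at t)"
    by (rule has_field_derivative_transform_within_open[where S = "{X 1<..<X n}"]) (use t assms(2) in auto)
  then have "(h has_real_derivative (\<Sum>j=2..n. D j)) (at_left t)" "(h has_real_derivative (\<Sum>j=2..n. D j)) (at_right t)"
    by (auto intro: has_field_derivative_at_within)
  then have "l = (\<Sum>j=2..n. D j)" "r = (\<Sum>j=2..n. D j)"
    using lr by (auto intro: has_field_derivative_unique)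
  then show False
    using lr by simp
qed

text \<open>The one-sided derivatives at \<open>X j\<close> are the slopes of the two adjacent
  segments, and their difference is the kink.\<close>

lemma knotsI:
  assumes "\<And>x. x \<in> supp \<Longrightarrow> h x = interp y x" "j \<in> {2..<n}" "kink y j \<noteq> 0"
  shows "X j \<in> knots (X 1) (X n) h"
proof -
  define k where "k = j - 1"
  have k: "k \<in> {1..<n}" "j \<in> {1..<n}" "j = k + 1"
    using assms by (auto simp: k_def)
  have X: "X 1 \<le> X k" "X k < X j" "X j < X (j + 1)" "X (j + 1) \<le> X n"
    using k X_less[of k j] X_less[of j "j+1"] X_le[of 1 k] X_le[of "j+1" n] by auto
  have "((\<lambda>x. y k + slope y k * (x - X k)) has_real_derivative slope y k) (at (X j) within {..X j})"
    by (auto intro!: derivative_eq_intros)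
  then have "(h has_real_derivative slope y k) (at (X j) within {..X j})"
  proof (rule has_field_derivative_transform_within)
    show "0 < X j - X k" using X by simp
    fix x assume "x \<in> {..X j}" "dist x (X j) < X j - X k"
    then show "y k + slope y k * (x - X k) = h x"
      using X k interp_segment[of k x y] assms(1)[of x] by (auto simp: dist_real_def)
  qed auto
  then have l: "(h has_real_derivative slope y k) (at_left (X j))"
    by (rule DERIV_subset) auto
  have "((\<lambda>x. y j + slope y j * (x - X j)) has_real_derivative slope y j) (at (X j) within {X j..})"
    by (auto intro!: derivative_eq_intros)
  then have "(h has_real_derivative slope y j) (at (X j) within {X j..})"
  proof (rule has_field_derivative_transform_within)
    show "0 < X (j + 1) - X j" using X by simp
    fix x assume "x \<in> {X j..}" "dist x (X j) < X (j + 1) - X j"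
    then show "y j + slope y j * (x - X j) = h x"
      using X k interp_segment[of j x y] assms(1)[of x] by (auto simp: dist_real_def)
  qed auto
  then have r: "(h has_real_derivative slope y j) (at_right (X j))"
    by (rule DERIV_subset) auto
  have "slope y k \<noteq> slope y j"
    using assms(3) by (simp add: kink_def k_def)
  with l r X show ?thesis
    by (auto simp: knots_def)
qed

section \<open>The mean gap as a linear functional\<close>

text \<open>The integral of \<open>v\<close> against \<open>d(F_n - F)\<close>, where
  \<open>F\<close> has the density \<open>exp g\<close> on \<open>supp\<close>.\<close>

definition mean_gap :: "(real \<Rightarrow> real) \<Rightarrow> (real \<Rightarrow> real) \<Rightarrow> real" where
  "mean_gap g v = sample_mean v - (LINT x|lborel. indicator supp x * (v x * exp (g x)))"

lemma integrable_weighted: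
  fixes g v :: "real \<Rightarrow> real"
  assumes "continuous_on supp g" "continuous_on supp v"
  shows "integrable lborel (\<lambda>x. indicator supp x * (v x * exp (g x)))"
  by (intro integrable_supp continuous_intros assms)

lemma mean_gap_add:
  assumes "continuous_on supp g" "continuous_on supp v" "continuous_on supp w"
  shows "mean_gap g (\<lambda>x. v x + w x) = mean_gap g v + mean_gap g w"
  unfolding mean_gap_def sample_mean_add
  using integrable_weighted[OF assms(1,2)] integrable_weighted[OF assms(1,3)]
  by (simp add: algebra_simps)

lemma mean_gap_cmult: "mean_gap g (\<lambda>x. c * v x) = c * mean_gap g v"
proof -
  have "(LINT x|lborel. indicator supp x * (c * v x * exp (g x))) =
      c * (LINT x|lborel. indicator supp x * (v x * exp (g x)))"
    by (subst integral_mult_right_zero[symmetric]) (simp add: mult_ac)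
  then show ?thesis
    by (simp add: mean_gap_def sample_mean_cmult right_diff_distrib)
qed

text \<open>The empirical measure and the density have the same total mass, so constants
  cancel.\<close>

lemma mean_gap_const:
  assumes "(LINT x|lborel. indicator supp x * exp (g x)) = 1"
  shows "mean_gap g (\<lambda>x. c) = 0"
  using mean_gap_cmult[of g c "\<lambda>_. 1"] assms by (simp add: mean_gap_def sample_mean_const)

lemma mean_gap_sum:
  assumes "continuous_on supp g" "\<And>j. j \<in> A \<Longrightarrow> continuous_on supp (v j)"
    "finite A"
  shows "mean_gap g (\<lambda>x. \<Sum>j\<in>A. v j x) = (\<Sum>j\<in>A. mean_gap g (v j))"
  using assms(3,2)
proof (induction A rule: finite_induct)
  case empty
  then show ?case by (simp add: mean_gap_def sample_mean_const)
next
  case (insert j A)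
  then show ?case
    using assms(1) by (simp add: mean_gap_add continuous_on_sum)
qed

text \<open>Both integrated distribution functions are means of the same hinge; their difference is
  \<open>\<Delta> t\<close>.\<close>

lemma mean_gap_hinge:
  assumes "continuous_on supp g" "t \<in> supp"
  shows "mean_gap g (\<lambda>x. max 0 (t - x)) =
    (LINT r:{X 1..t}|lborel. empirical_cdf n X r)
      - (LINT r:{X 1..t}|lborel. cdf_of_log_density (extend g) r)"
  unfolding mean_gap_def integral_empirical_cdf[OF assms(2)] integral_cdf_of_log_density[OF assms] ..

lemma mean_gap_interp:
  assumes "continuous_on supp g" "(LINT x|lborel. indicator supp x * exp (g x)) = 1"
  shows "mean_gap g (interp y) = (\<Sum>j=2..n. kink y j * mean_gap g (\<lambda>x. max 0 (X j - x)))"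
proof -
  have "mean_gap g (interp y) = mean_gap g (\<lambda>x. y n) + mean_gap g (\<lambda>x. \<Sum>j=2..n. kink y j * max 0 (X j - x))"
    unfolding interp_def by (rule mean_gap_add[OF assms(1)]) (intro continuous_intros)+
  also have "mean_gap g (\<lambda>x. \<Sum>j=2..n. kink y j * max 0 (X j - x)) =
      (\<Sum>j=2..n. mean_gap g (\<lambda>x. kink y j * max 0 (X j - x)))"
    by (rule mean_gap_sum[OF assms(1)]) (auto intro!: continuous_intros)
  finally show ?thesis
    by (simp add: mean_gap_const[OF assms(2)] mean_gap_cmult)
qed

section \<open>Necessity: perturbation of a maximizer\<close>

text \<open>First-order optimality: \<open>mean_gap g w\<close> is the directional derivative of \<open>Psi\<close> at \<open>g\<close>.\<close>

lemma mle_mean_gap_nonpos: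
  assumes g: "continuous_on supp g" "(LINT x|lborel. indicator supp x * exp (g x)) = 1"
    and w: "continuous_on supp w"
    and \<delta>: "\<delta> > 0"
    and concave: "\<And>\<epsilon>. 0 < \<epsilon> \<Longrightarrow> \<epsilon> \<le> \<delta> \<Longrightarrow> concave_on supp (\<lambda>x. g x + \<epsilon> * w x)"
    and mle: "log_concave_mle n X (extend g)"
  shows "mean_gap g w \<le> 0"
proof -
  have "bounded (w ` supp)"
    by (intro compact_imp_bounded compact_continuous_image w) simp
  then obtain M where M: "\<And>x. x \<in> supp \<Longrightarrow> \<bar>w x\<bar> \<le> M" and Mpos: "M > 0"
    unfolding bounded_pos by force
  \<comment> \<open>Maximality against the perturbation by \<open>\<epsilon> * w\<close> leaves an
    error of order \<open>\<epsilon>\<^sup>2\<close>, and division by \<open>\<epsilon>\<close>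
    gives this bound. The condition \<open>\<epsilon> \<le> 1 / M\<close> keeps the exponent in the
    range of the quadratic estimate.\<close>
  have bound: "mean_gap g w \<le> \<epsilon> * M\<^sup>2" if \<epsilon>: "0 < \<epsilon>" "\<epsilon> \<le> \<delta>" "\<epsilon> \<le> 1 / M" for \<epsilon>
  proof -
    have "Psi n X (extend (\<lambda>x. g x + \<epsilon> * w x)) \<le> Psi n X (extend g)"
      using mle concave[OF \<epsilon>(1,2)] ext_concave_extend unfolding log_concave_mle_def extend_def by blast
    then have "sample_mean (\<lambda>x. g x + \<epsilon> * w x) - (LINT x|lborel. indicator supp x * exp (g x + \<epsilon> * w x))
        \<le> sample_mean g - 1"
      by (simp add: Psi_extend g w continuous_intros)
    then have "\<epsilon> * sample_mean w \<le> (LINT x|lborel. indicator supp x * exp (g x + \<epsilon> * w x)) - 1"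
      by (simp add: sample_mean_add sample_mean_cmult)
    also have "(LINT x|lborel. indicator supp x * exp (g x + \<epsilon> * w x))
        \<le> (LINT x|lborel. indicator supp x * ((1 + (\<epsilon> * M)\<^sup>2) * exp (g x)) + \<epsilon> * (indicator supp x * (w x * exp (g x))))"
    proof (rule integral_mono)
      show "integrable lborel (\<lambda>x. indicator supp x * exp (g x + \<epsilon> * w x))"
        using g w by (intro integrable_supp continuous_intros)
      show "integrable lborel (\<lambda>x. indicator supp x * ((1 + (\<epsilon> * M)\<^sup>2) * exp (g x)) + \<epsilon> * (indicator supp x * (w x * exp (g x))))"
        using g w by (intro Bochner_Integration.integrable_add integrable_mult_right integrable_supp continuous_intros)
      fix x
      show "indicator supp x * exp (g x + \<epsilon> * w x) \<le>
         indicator supp x * ((1 + (\<epsilon> * M)\<^sup>2) * exp (g x)) + \<epsilon> * (indicator supp x * (w x * exp (g x)))"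
      proof (cases "x \<in> supp")
        case True
        have le: "\<bar>\<epsilon> * w x\<bar> \<le> \<epsilon> * M"
          using M[OF True] \<epsilon> by (simp add: abs_mult)
        also have "\<dots> \<le> 1"
          using \<epsilon> Mpos by (simp add: field_simps)
        finally have "exp (\<epsilon> * w x) \<le> 1 + \<epsilon> * w x + (\<epsilon> * w x)\<^sup>2"
          by (rule exp_le_quadratic)
        also have "(\<epsilon> * w x)\<^sup>2 \<le> (\<epsilon> * M)\<^sup>2"
          using le \<epsilon> Mpos by (subst abs_le_square_iff[symmetric]) auto
        finally have "exp (g x) * exp (\<epsilon> * w x) \<le> exp (g x) * (1 + \<epsilon> * w x + (\<epsilon> * M)\<^sup>2)"
          by simp
        then show ?thesis
          using True by (simp add: exp_add algebra_simps)
      qed auto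
    qed
    also have "\<dots> = (1 + (\<epsilon> * M)\<^sup>2) + \<epsilon> * (LINT x|lborel. indicator supp x * (w x * exp (g x)))"
    proof -
      have "(LINT x|lborel. indicator supp x * ((1 + (\<epsilon> * M)\<^sup>2) * exp (g x))) = 1 + (\<epsilon> * M)\<^sup>2"
        using g(2) integral_mult_right_zero[of lborel "1 + (\<epsilon> * M)\<^sup>2" "\<lambda>x. indicator supp x * exp (g x)"]
        by (simp add: mult_ac)
      then show ?thesis
        using g w by (subst Bochner_Integration.integral_add)
          (auto intro!: integrable_supp integrable_mult_right continuous_intros)
    qed
    finally have "\<epsilon> * mean_gap g w \<le> \<epsilon> * (\<epsilon> * M\<^sup>2)"
      by (simp add: mean_gap_def power2_eq_square algebra_simps)
    then show ?thesis
      using \<epsilon> by simp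
  qed
  show ?thesis
  proof (rule ccontr)
    assume "\<not> ?thesis"
    then have pos: "mean_gap g w > 0" by simp
    \<comment> \<open>The last bound gives
      \<open>\<epsilon> * M\<^sup>2 \<le> mean_gap g w / 2\<close>, which contradicts the estimate
      for a positive gap.\<close>
    define \<epsilon> where "\<epsilon> = min (min \<delta> (1 / M)) (mean_gap g w / (2 * M\<^sup>2))"
    have "\<epsilon> > 0" "\<epsilon> \<le> \<delta>" "\<epsilon> \<le> 1 / M"
      using pos \<delta> Mpos by (auto simp: \<epsilon>_def)
    from bound[OF this] have "mean_gap g w \<le> \<epsilon> * M\<^sup>2" .
    also have "\<dots> \<le> mean_gap g w / (2 * M\<^sup>2) * M\<^sup>2"
      by (intro mult_right_mono) (auto simp: \<epsilon>_def)
    also have "\<dots> = mean_gap g w / 2"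
      using Mpos by (simp add: field_simps)
    finally show False
      using pos by simp
  qed
qed

lemma mle_imp_hinge_conditions:
  assumes y: "\<And>j. j \<in> {2..<n} \<Longrightarrow> kink y j \<le> 0"
    and one: "(LINT x|lborel. indicator supp x * exp (interp y x)) = 1"
    and mle: "log_concave_mle n X (extend (interp y))"
    and h: "\<And>x. x \<in> supp \<Longrightarrow> h x = interp y x"
    and t: "t \<in> supp"
  shows "mean_gap (interp y) (\<lambda>x. max 0 (t - x)) \<ge> 0"
    and "t \<in> knots (X 1) (X n) h \<Longrightarrow> mean_gap (interp y) (\<lambda>x. max 0 (t - x)) = 0"
proof -
  have g: "concave_on supp (interp y)"
    unfolding interp_def using y by (rule concave_on_hinges)
  have "mean_gap (interp y) (\<lambda>x. (-1) * max 0 (t - x)) \<le> 0"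
  proof (rule mle_mean_gap_nonpos[OF _ one _ zero_less_one _ mle])
    fix \<epsilon> :: real assume "0 < \<epsilon>"
    then have "concave_on supp (\<lambda>x. (- \<epsilon>) * max 0 (t - x))"
      by (intro concave_on_hinge) auto
    with g have "concave_on supp (\<lambda>x. interp y x + (- \<epsilon>) * max 0 (t - x))"
      by (rule concave_on_add)
    then show "concave_on supp (\<lambda>x. interp y x + \<epsilon> * ((-1) * max 0 (t - x)))"
      by simp
  qed (intro continuous_intros)+
  then show nonneg: "mean_gap (interp y) (\<lambda>x. max 0 (t - x)) \<ge> 0"
    by (subst (asm) mean_gap_cmult) simp
  assume knot: "t \<in> knots (X 1) (X n) h"
  show "mean_gap (interp y) (\<lambda>x. max 0 (t - x)) = 0"
  proof (cases "t = X 1")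
    case True
    \<comment> \<open>At the left end both integrals run over a single point, which has measure
      zero.\<close>
    have "(LINT r:{X 1..t}|lborel. f r) = 0" for f :: "real \<Rightarrow> real"
      unfolding True atLeastAtMost_singleton set_lebesgue_integral_def
      by (intro integral_eq_zero_AE, use AE_lborel_singleton[of "X 1"] in eventually_elim) simp
    then show ?thesis
      unfolding mean_gap_hinge[OF continuous_on_interp t] by simp
  next
    case False
    have "\<exists>j\<in>{2..n}. t = X j \<and> (j < n \<longrightarrow> kink y j < 0)"
    proof (cases "t = X n")
      case True
      then show ?thesis using n by (intro bexI[of _ n]) auto
    next
      case F: False
      obtain j where "j \<in> {2..<n}" "t = X j" "kink y j \<noteq> 0"
        using knotsE[OF knot h False F] .
      then show ?thesis
        using y[of j] by (intro bexI[of _ j]) auto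
    qed
    then obtain j where j: "j \<in> {2..n}" "t = X j" "j < n \<Longrightarrow> kink y j < 0"
      by blast
    \<comment> \<open>Raising the coefficient at an interior \<open>X j\<close> keeps concavity as
      long as it stays nonpositive, which admits the amount \<open>- kink y j\<close>. At
      \<open>X n\<close> the hinge is affine on \<open>supp\<close>, so any positive amount would
      do.\<close>
    define \<delta> where "\<delta> = (if j < n then - kink y j else 1)"
    have "mean_gap (interp y) (\<lambda>x. max 0 (t - x)) \<le> 0"
    proof (rule mle_mean_gap_nonpos[OF _ one _ _ _ mle])
      show "\<delta> > 0" using j by (auto simp: \<delta>_def)
      fix \<epsilon> assume \<epsilon>: "0 < \<epsilon>" "\<epsilon> \<le> \<delta>"
      define c where "c = (\<lambda>i. kink y i + (if i = j then \<epsilon> else 0))"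
      have "concave_on supp (\<lambda>x. y n + (\<Sum>i=2..n. c i * max 0 (X i - x)))"
        using y \<epsilon> by (intro concave_on_hinges) (auto simp: c_def \<delta>_def)
      also have "(\<lambda>x. y n + (\<Sum>i=2..n. c i * max 0 (X i - x))) = (\<lambda>x. interp y x + \<epsilon> * max 0 (t - x))"
      proof
        fix x
        have "(\<Sum>i=2..n. c i * max 0 (X i - x)) =
            (\<Sum>i=2..n. kink y i * max 0 (X i - x) + (if i = j then \<epsilon> * max 0 (X j - x) else 0))"
          by (intro sum.cong) (auto simp: c_def distrib_right)
        also have "\<dots> = (\<Sum>i=2..n. kink y i * max 0 (X i - x)) + \<epsilon> * max 0 (t - x)"
          using j(1,2) by (simp only: sum.distrib sum.delta[OF finite_atLeastAtMost] if_True)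
        finally show "y n + (\<Sum>i=2..n. c i * max 0 (X i - x)) = interp y x + \<epsilon> * max 0 (t - x)"
          by (simp add: interp_def)
      qed
      finally show "concave_on supp (\<lambda>x. interp y x + \<epsilon> * max 0 (t - x))" .
    qed (intro continuous_intros)+
    with nonneg show ?thesis by simp
  qed
qed

section \<open>Sufficiency: a competitor at least as good as the candidate equals it\<close>

text \<open>The conditions bound the mean gap of the interpolant of \<open>\<psi>\<close>. A
  pointwise nonnegative excess \<open>E\<close> then has nonpositive integral, and its vanishing
  almost everywhere is turned into equality everywhere by concavity and piecewise linearity.\<close>

lemma hinge_conditions_imp_eq:
  assumes y: "\<And>j. j \<in> {2..<n} \<Longrightarrow> kink y j \<le> 0"
    and one: "(LINT x|lborel. indicator supp x * exp (interp y x)) = 1"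
    and nonneg: "\<And>j. j \<in> {2..n} \<Longrightarrow> mean_gap (interp y) (\<lambda>x. max 0 (X j - x)) \<ge> 0"
    and zero: "\<And>j. j \<in> {2..n} \<Longrightarrow> j = n \<or> kink y j \<noteq> 0 \<Longrightarrow> mean_gap (interp y) (\<lambda>x. max 0 (X j - x)) = 0"
    and \<psi>: "ext_concave \<psi>" "Psi n X (extend (interp y)) \<le> Psi n X \<psi>"
  shows "\<psi> = extend (interp y)"
proof -
  let ?g = "interp y"
  have "Psi n X (extend ?g) \<noteq> -\<infinity>"
    by (simp add: Psi_extend continuous_intros)
  then have Psi: "Psi n X \<psi> \<noteq> -\<infinity>"
    using \<psi>(2) by auto
  define z where "z = (\<lambda>j. real_of_ereal (\<psi> (X j)))"
  have z: "\<psi> (X j) = ereal (z j)" if "j \<in> {1..n}" for j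
    unfolding z_def using Psi_not_MInfD(1)[OF \<psi>(1) Psi that] .
  have int: "integrable lborel (\<lambda>x. exp_ext (\<psi> x))"
    using Psi_not_MInfD(2)[OF \<psi>(1) Psi] .
  let ?v = "interp z"
  \<comment> \<open>The excess of \<open>exp \<psi>\<close> over the tangent of \<open>exp\<close>
    at \<open>?g\<close>, evaluated at the interpolant \<open>?v\<close> of \<open>\<psi>\<close>.
    Outside \<open>supp\<close> it is just \<open>exp_ext (\<psi> x)\<close>.\<close>
  define E where "E = (\<lambda>x. exp_ext (\<psi> x) - (indicator supp x * exp (?g x) + indicator supp x * ((?v x - ?g x) * exp (?g x))))"
  have intE: "integrable lborel E"
    unfolding E_def by (intro Bochner_Integration.integrable_diff Bochner_Integration.integrable_add int integrable_supp continuous_intros)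
  have "Psi n X \<psi> = ereal (sample_mean ?v - (LINT x|lborel. exp_ext (\<psi> x)))"
    using z interp_X by (intro Psi_eq int) auto
  then have le: "sample_mean ?g - 1 \<le> sample_mean ?v - (LINT x|lborel. exp_ext (\<psi> x))"
    using \<psi>(2) by (simp add: Psi_extend continuous_intros one)
  have gap: "mean_gap ?g (\<lambda>x. ?v x - ?g x) = mean_gap ?g ?v - mean_gap ?g ?g"
    using mean_gap_add[of ?g ?v "\<lambda>x. (-1) * ?g x"] mean_gap_cmult[of ?g "-1" ?g]
    by (simp add: continuous_intros)
  \<comment> \<open>Interior kinks are nonpositive by concavity of \<open>\<psi>\<close>. The last
    coefficient has no prescribed sign, but the gap at \<open>X n\<close> is zero.\<close>
  have "mean_gap ?g ?v \<le> 0"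
    unfolding mean_gap_interp[OF continuous_on_interp one, of z]
  proof (rule sum_nonpos)
    fix j assume j: "j \<in> {2..n}"
    show "kink z j * mean_gap ?g (\<lambda>x. max 0 (X j - x)) \<le> 0"
    proof (cases "j = n")
      case False
      then show ?thesis
        using kink_nonpos[of \<psi> z j] \<psi>(1) z j nonneg[of j] by (auto intro!: mult_nonpos_nonneg)
    qed (use zero j in auto)
  qed
  \<comment> \<open>In each summand either the kink or, by \<open>zero\<close>, the gap
    vanishes.\<close>
  moreover have "mean_gap ?g ?g = 0"
    unfolding mean_gap_interp[OF continuous_on_interp one, of y] using zero
    by (intro sum.neutral) (metis mult_eq_0_iff)
  ultimately have "mean_gap ?g (\<lambda>x. ?v x - ?g x) \<le> 0"
    using gap by simp
  moreover have "(LINT x|lborel. E x) = (LINT x|lborel. exp_ext (\<psi> x)) - (1 + (LINT x|lborel. indicator supp x * ((?v x - ?g x) * exp (?g x))))"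
    unfolding E_def one[symmetric]
    by (subst Bochner_Integration.integral_diff, rule int,
        intro Bochner_Integration.integrable_add integrable_supp continuous_intros,
        subst Bochner_Integration.integral_add)
       (auto intro!: integrable_supp continuous_intros)
  \<comment> \<open>By \<open>le\<close>, the integral of \<open>E\<close> is at most
    \<open>mean_gap ?g (\<lambda>x. ?v x - ?g x)\<close>.\<close>
  ultimately have E_le: "(LINT x|lborel. E x) \<le> 0"
    using le by (simp add: mean_gap_def sample_mean_diff)
  have ge: "ereal (?v x) \<le> \<psi> x" if "x \<in> supp" for x
    using ext_concave_ge_interp[OF \<psi>(1) z that] by simp
  have exp_ge: "exp (?v x) \<le> exp_ext (\<psi> x)" if "x \<in> supp" for x
    using exp_ext_mono[OF ge[OF that]] ext_concave_not_PInf[OF \<psi>(1)] by simp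
  have tangent: "exp a \<ge> exp b + (a - b) * exp b" for a b :: real
  proof -
    have "(1 + (a - b)) * exp b \<le> exp (a - b) * exp b"
      by (intro mult_right_mono) (use exp_ge_add_one_self in auto)
    then show ?thesis by (simp add: algebra_simps flip: exp_add)
  qed
  have E_nonneg: "E x \<ge> 0" for x
  proof (cases "x \<in> supp")
    case True
    then show ?thesis
      using exp_ge[OF True] tangent[of "?g x" "?v x"] by (simp add: E_def)
  qed (simp add: E_def)
  have "(LINT x|lborel. E x) = 0"
    using E_le Bochner_Integration.integral_nonneg[of lborel E] E_nonneg by fastforce
  then have AE0: "AE x in lborel. E x = 0"
    using integral_nonneg_eq_0_iff_AE[OF intE] E_nonneg by simp
  \<comment> \<open>A zero of \<open>E\<close> forces equality both in
    \<open>exp (?v x) \<le> exp_ext (\<psi> x)\<close> and in the tangent inequality; by strict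
    convexity of \<open>exp\<close> the latter is an equality only for
    \<open>?v x = ?g x\<close>.\<close>
  have E0: "?v x = ?g x" "\<psi> x = ereal (?g x)" if "x \<in> supp" "E x = 0" for x
  proof -
    have eq: "exp_ext (\<psi> x) = exp (?g x) + (?v x - ?g x) * exp (?g x)"
      using that by (simp add: E_def)
    have "exp (?g x) * exp (?v x - ?g x) \<le> exp (?g x) * (1 + (?v x - ?g x))"
      using exp_ge[OF that(1)] eq by (simp add: algebra_simps flip: exp_add)
    then have "exp (?v x - ?g x) \<le> 1 + (?v x - ?g x)"
      by simp
    then have "exp (?v x - ?g x) = 1 + (?v x - ?g x)"
      using exp_ge_add_one_self[of "?v x - ?g x"] by linarith
    then have "ln (exp (?v x - ?g x)) = exp (?v x - ?g x) - 1"
      unfolding ln_exp by simp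
    then have "exp (?v x - ?g x) = 1"
      by (rule ln_eq_minus_one[OF exp_gt_zero])
    then show v: "?v x = ?g x"
      by simp
    have "exp_ext (\<psi> x) = exp (?g x)"
      using eq v by simp
    then show "\<psi> x = ereal (?g x)"
      using ge[OF that(1)] ext_concave_not_PInf[OF \<psi>(1), of x]
      by (cases "\<psi> x") auto
  qed
  have zy: "z k = y k" "z (k + 1) = y (k + 1)" if k: "k \<in> {1..<n}" for k
  proof -
    have X: "X 1 \<le> X k" "X k < X (k + 1)" "X (k + 1) \<le> X n"
      using k X_less[of k "k+1"] X_le[of 1 k] X_le[of "k+1" n] by auto
    \<comment> \<open>The midpoint separates the two zeros of \<open>E\<close>, so that they are
      distinct; affine functions agreeing at both coincide on the segment.\<close>
    define m where "m = (X k + X (k + 1)) / 2"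
    obtain a where a: "X k < a" "a < m" "E a = 0"
      using AE_lborel_point_in_interval[OF AE0, of "X k" m] X by (auto simp: m_def)
    obtain b where b: "m < b" "b < X (k + 1)" "E b = 0"
      using AE_lborel_point_in_interval[OF AE0, of m "X (k + 1)"] X by (auto simp: m_def)
    have "?v a = ?g a" "?v b = ?g b"
      using E0(1) a b X by auto
    then have "z k + slope z k * (a - X k) = y k + slope y k * (a - X k)"
        "z k + slope z k * (b - X k) = y k + slope y k * (b - X k)"
      using interp_segment[OF k, of a] interp_segment[OF k, of b] a b by auto
    then have *: "z k - y k = (slope y k - slope z k) * (a - X k)" "z k - y k = (slope y k - slope z k) * (b - X k)"
      by (simp_all add: algebra_simps)
    then have "(slope y k - slope z k) * (b - a) = 0"
      by (simp add: algebra_simps)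
    then have s: "slope y k = slope z k"
      using a b by simp
    then show "z k = y k"
      using * by simp
    then show "z (k + 1) = y (k + 1)"
      using s slope_times[OF k, of z] slope_times[OF k, of y] by simp
  qed
  have inside: "\<psi> x = ereal (?g x)" if "x \<in> supp" for x
  proof -
    obtain k where k: "k \<in> {1..<n}" "X k \<le> x" "x \<le> X (k + 1)"
      using segment_of[OF \<open>x \<in> supp\<close>] .
    have X: "X 1 \<le> X k" "X (k + 1) \<le> X n"
      using k X_le[of 1 k] X_le[of "k+1" n] by auto
    consider "x = X k" | "x = X (k + 1)" | "X k < x" "x < X (k + 1)"
      using k by linarith
    then show ?thesis
    proof cases
      \<comment> \<open>It remains to bound \<open>\<psi> x\<close> from above. If it exceeded
        \<open>?g x\<close>, the chord from \<open>X k\<close> to \<open>x\<close> would lie above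
        \<open>?g\<close> at the intermediate zero \<open>a\<close> of \<open>E\<close>, where
        \<open>\<psi>\<close> equals \<open>?g\<close>.\<close>
      case 3
      obtain a where a: "X k < a" "a < x" "E a = 0"
        using AE_lborel_point_in_interval[OF AE0 3(1)] .
      have "slope z k = slope y k"
        using zy[OF k(1)] by (simp add: slope_def)
      then have vx: "?v x = ?g x"
        using interp_segment[OF k, of z] interp_segment[OF k, of y] zy[OF k(1)] by simp
      obtain p where p: "\<psi> x = ereal p" "?g x \<le> p"
        using ge[OF \<open>x \<in> supp\<close>] ext_concave_not_PInf[OF \<psi>(1), of x] vx by (cases "\<psi> x") auto
      have "\<psi> a = ereal (?g a)"
        using E0(2)[of a] a X 3 by auto
      moreover have "\<psi> a \<ge> ereal (y k + (p - y k) / (x - X k) * (a - X k))"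
        using ext_concave_chord[OF \<psi>(1) a(1,2), of "y k" p] p z[of k] zy[OF k(1)] k by auto
      moreover have "?g a = y k + slope y k * (a - X k)"
        using interp_segment[OF k(1), of a y] a 3 by simp
      ultimately have "(p - y k) / (x - X k) * (a - X k) \<le> slope y k * (a - X k)"
        by simp
      then have "(p - y k) / (x - X k) \<le> slope y k"
        by (rule mult_right_le_imp_le) (use a in simp)
      then have "p \<le> y k + slope y k * (x - X k)"
        using 3 by (simp add: field_simps)
      then show ?thesis
        using p interp_segment[OF k, of y] by simp
    qed (use z[of k] z[of "k+1"] zy[OF k(1)] k interp_X[of k y] interp_X[of "k+1" y] in auto)
  qed
  have outside: "\<psi> x = -\<infinity>" if "x \<notin> supp" for x
  proof (rule ccontr)
    assume x: "\<psi> x \<noteq> -\<infinity>"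
    \<comment> \<open>Finiteness at \<open>x\<close> spreads by concavity to the whole open interval
      between \<open>x\<close> and \<open>supp\<close>, whereas a zero \<open>c\<close> of
      \<open>E\<close> in it requires \<open>exp_ext (\<psi> c) = 0\<close>.\<close>
    obtain a b where ab: "a < b" "{a<..<b} \<inter> supp = {}" "\<And>c. a < c \<Longrightarrow> c < b \<Longrightarrow> \<psi> c \<noteq> -\<infinity>"
    proof (cases "x < X 1")
      case True
      show ?thesis
        using ext_concave_finite_between[OF \<psi>(1), of x _ "X 1"] x inside[of "X 1"] X_1_less_n True
        by (intro that[of x "X 1"]) auto
    next
      case False
      then have "X n < x" using \<open>x \<notin> supp\<close> by auto
      then show ?thesis
        using ext_concave_finite_between[OF \<psi>(1), of "X n" _ x] x inside[of "X n"] X_1_less_n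
        by (intro that[of "X n" x]) auto
    qed
    obtain c where c: "a < c" "c < b" "E c = 0"
      using AE_lborel_point_in_interval[OF AE0 ab(1)] .
    then have "c \<notin> supp"
      using ab(2) by auto
    then have "exp_ext (\<psi> c) = 0"
      using c(3) by (simp add: E_def)
    then show False
      using ab(3)[OF c(1,2)] ext_concave_not_PInf[OF \<psi>(1), of c] by (auto simp: exp_ext_eq_0_iff)
  qed
  show ?thesis
    using inside outside by (auto simp: extend_def)
qed

end

section \<open>The characterization of the log-concave estimator\<close>

theorem theorem2p4:
  fixes n :: nat and X :: "nat \<Rightarrow> real" and \<phi>_hat \<phi>_tilde :: "real \<Rightarrow> ereal"
  assumes "n > 1"
    and "strict_mono_on {1..n} X"
    and "log_concave_mle n X \<phi>_hat"
    and "ext_concave \<phi>_tilde"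
    and "\<forall>j\<in>{1..<n}. linear_on_interval \<phi>_tilde (X j) (X (j + 1))"
    and "\<forall>x. x \<notin> {X 1..X n} \<longrightarrow> \<phi>_tilde x = -\<infinity>"
    and "cdf_of_log_density \<phi>_tilde (X n) = 1"
  shows "(\<phi>_tilde = \<phi>_hat \<and> cdf_of_log_density \<phi>_tilde = cdf_of_log_density \<phi>_hat) \<longleftrightarrow>
    (\<forall>t\<in>{X 1..X n}.
       (LINT r:{X 1..t}|lborel. cdf_of_log_density \<phi>_tilde r)
         \<le> (LINT r:{X 1..t}|lborel. empirical_cdf n X r) \<and>
       (t \<in> knots (X 1) (X n) (\<lambda>x. real_of_ereal (\<phi>_tilde x)) \<longrightarrow>
         (LINT r:{X 1..t}|lborel. cdf_of_log_density \<phi>_tilde r)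
           = (LINT r:{X 1..t}|lborel. empirical_cdf n X r)))"
proof -
  interpret ordered_sample n X
    using assms(1,2) by unfold_locales
  define y where "y = (\<lambda>j. real_of_ereal (\<phi>_tilde (X j)))"
  have \<phi>: "\<phi>_tilde x = ereal (interp y x)" if "x \<in> supp" for x
    unfolding y_def by (rule linear_on_segments_eq_interp[OF assms(5) that])
  have ext: "\<phi>_tilde = extend (interp y)"
    using \<phi> assms(6) by (auto simp: extend_def)
  have h: "real_of_ereal (\<phi>_tilde x) = interp y x" if "x \<in> supp" for x
    using \<phi>[OF that] by simp
  have kink: "kink y j \<le> 0" if "j \<in> {2..<n}" for j
    using kink_nonpos[OF assms(4) _ that, of y] \<phi> interp_X X_in_supp by auto
  have one: "(LINT x|lborel. indicator supp x * exp (interp y x)) = 1"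
  proof -
    have "(LINT x|lborel. indicator supp x * exp (interp y x)) = cdf_of_log_density \<phi>_tilde (X n)"
      unfolding cdf_of_log_density_def set_lebesgue_integral_def ext exp_ext_extend
      by (intro Bochner_Integration.integral_cong) (auto simp: indicator_def)
    then show ?thesis
      using assms(7) by simp
  qed
  have gap: "mean_gap (interp y) (\<lambda>x. max 0 (t - x)) =
      (LINT r:{X 1..t}|lborel. empirical_cdf n X r) - (LINT r:{X 1..t}|lborel. cdf_of_log_density \<phi>_tilde r)"
    if "t \<in> supp" for t
    unfolding ext by (rule mean_gap_hinge[OF continuous_on_interp that])
  let ?knots = "knots (X 1) (X n) (\<lambda>x. real_of_ereal (\<phi>_tilde x))"
  \<comment> \<open>Equal log-densities have equal distribution functions, so the left side of the
    claim amounts to this single equation.\<close>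
  have "\<phi>_tilde = \<phi>_hat \<longleftrightarrow> (\<forall>t\<in>supp. mean_gap (interp y) (\<lambda>x. max 0 (t - x)) \<ge> 0 \<and>
      (t \<in> ?knots \<longrightarrow> mean_gap (interp y) (\<lambda>x. max 0 (t - x)) = 0))" (is "_ \<longleftrightarrow> ?R")
  proof
    assume "\<phi>_tilde = \<phi>_hat"
    then have mle: "log_concave_mle n X (extend (interp y))"
      using assms(3) ext by simp
    show ?R
      using mle_imp_hinge_conditions[OF kink one mle h] by blast
  next
    assume R: ?R
    have "\<phi>_hat = extend (interp y)"
    \<comment> \<open>Here \<open>\<phi>_hat\<close> is the competitor; its maximality supplies the
      inequality between the values of \<open>Psi\<close>.\<close>
    proof (rule hinge_conditions_imp_eq[OF kink one])
      fix j assume j: "j \<in> {2..n}"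
      then have t: "X j \<in> supp"
        using X_in_supp[of j] by auto
      then show "mean_gap (interp y) (\<lambda>x. max 0 (X j - x)) \<ge> 0"
        using R by blast
      assume "j = n \<or> kink y j \<noteq> 0"
      then have "X j \<in> ?knots"
      proof (cases "j = n")
        case True
        then show ?thesis by (simp add: knots_def)
      next
        case False
        with \<open>j = n \<or> kink y j \<noteq> 0\<close> j show ?thesis
          by (intro knotsI[OF h]) auto
      qed
      with R t show "mean_gap (interp y) (\<lambda>x. max 0 (X j - x)) = 0"
        by blast
    qed (use assms(3,4) ext in \<open>auto simp: log_concave_mle_def\<close>)
    then show "\<phi>_tilde = \<phi>_hat"
      using ext by simp
  qed
  then show ?thesis
    using gap by fastforce
qed

end
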